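(* Consider the rod with hardening under the assumptions of the context, in either Case A (expanding elastic range) or Case B (linear kinematic hardening). For any $\bm{\widetilde\sigma}\in L^2_{\mathbf{C}^{-1}}(\Omega)$ denote $$\mathcal{C}_1=\widehat\Sigma-\begin{pmatrix}\bm{\widetilde\sigma}\\0\end{pmatrix},\qquad\mathcal{C}_2=\mathcal{V}\times L^2(\Omega),$$ as subsets of $\widehat{\mathcal H}=L^2_{\mathbf{C}^{-1}}(\Omega)\times L^2(\Omega)$. Then constraint qualification (i) $\mathcal{C}_1\cap\mathrm{int}\,\mathcal{C}_2\neq\varnothing$ fails, but all of the following constraint qualifications are satisfied: (ii) $0\in\mathrm{int}(\mathcal{C}_1-\mathcal{C}_2)$; (iii) $\{\lambda(\bm c_1-\bm c_2):\lambda\ge0,\ \bm c_1\in\mathcal{C}_1,\ \bm c_2\in\mathcal{C}_2\}=\widehat{\mathcal H}$; (iv) $\{\lambda(\bm c_1-\bm c_2):\lambda\ge0,\ \bm c_1\in\mathcal{C}_1,\ \bm c_2\in\mathcal{C}_2\}$ is a closed linear subspace of $\widehat{\mathcal H}$.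
   Context: $\Omega=(a,b)$, $a<b$. $\bm C\in L^\infty(\Omega)$ satisfies $0<c_0\le\bm C(x)\le C_0$ for a.a. $x\in\Omega$. $L^2_{\mathbf{C}^{-1}}(\Omega)$ is $L^2(\Omega)$ with the inner product $\int_\Omega\frac{\tau_1\tau_2}{\bm C}\,dx$; $\widehat{\mathcal H}$ has the product inner product. $\mathcal{V}\subset L^2_{\mathbf{C}^{-1}}(\Omega)$ is the one-dimensional subspace of (a.e.) constant functions. The yield limits are functions $(x,\xi)\in\Omega\times\mathbb{R}\mapsto\sigma^-_x(\xi)\in\mathbb{R}$ and $(x,\xi)\mapsto\sigma^+_x(\xi)\in\mathbb{R}$ and $$\widehat\Sigma=\left\{\begin{pmatrix}\bm\sigma\\ \bm\xi\end{pmatrix}\in L^2(\Omega)\times L^2(\Omega):\sigma^-_x(\xi(x))\le\sigma(x)\le\sigma^+_x(\xi(x))\text{ for a.a. }x\in\Omega\right\}.$$ For a.a. $x\in\Omega$, $\xi\mapsto\sigma^-_x(\xi)$ is convex, strictly monotone and surjective onto $\mathbb{R}$, and $\xi\mapsto\sigma^+_x(\xi)$ is concave, strictly monotone and surjective onto $\mathbb{R}$. There is a given (initial) internal variable $\bm\xi_0\in L^2(\Omega)$ with $\sigma^-_x(\xi_0(x))<\sigma^+_x(\xi_0(x))$ for a.a. $x\in\Omega$. Case A (expanding elastic range, e.g. nonlinear isotropic hardening). For a.a. $x$, $\sigma^+_x$ is increasing and $\sigma^-_x$ is decreasing in $\xi$; $\xi^+_x,\xi^-_x:\mathbb{R}\to\mathbb{R}$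 denote the inverse functions of $\sigma^+_x,\sigma^-_x$. For each $\xi\in\mathbb{R}$ the maps $x\mapsto\sigma^\pm_x(\xi)$ are Lebesgue-measurable (so that $(x,\sigma)\mapsto\xi^\pm_x(\sigma)$ are Carathéodory functions). There exist $\psi\in L^2(\Omega)$ and $c>0$ such that for a.a. $x\in\Omega$ and all $\sigma\in\mathbb{R}$, $\max(|\xi^-_x(\sigma)|,|\xi^+_x(\sigma)|)\le\psi(x)+c|\sigma|$. Case B (linear kinematic hardening). $\sigma^\pm_x(\xi)=\sigma^\pm_{\rm offset}(x)+\bm H(x)\xi$ with $\sigma^\pm_{\rm offset}\in L^\infty(\Omega)$, $\bm H\in L^\infty(\Omega)$, and there is $\eta\in\mathbb R$ with $0<\eta\le\bm H(x)$ for a.a. $x\in\Omega$. *)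

theory Defs
  imports "HOL-Analysis.Analysis"
begin

section \<open>The spaces \<open>L\<^sup>2\<close> and \<open>L\<^sup>\<infinity>\<close>\<close>

definition sq_int :: "'a measure \<Rightarrow> ('a \<Rightarrow> real) set" where
  "sq_int M = {f. f \<in> borel_measurable M \<and> integrable M (\<lambda>x. (f x)\<^sup>2)}"

definition ess_bounded :: "'a measure \<Rightarrow> ('a \<Rightarrow> real) set" where
  "ess_bounded M = {f. f \<in> borel_measurable M \<and> (\<exists>K. AE x in M. \<bar>f x\<bar> \<le> K)}"

definition ae_rel :: "'a measure \<Rightarrow> (('a \<Rightarrow> real) \<times> ('a \<Rightarrow> real)) set" where
  "ae_rel M = {(f, g). f \<in> sq_int M \<and> g \<in> sq_int M \<and> (AE x in M. f x = g x)}"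

type_synonym 'a l2 = "('a \<Rightarrow> real) set"

definition L2 :: "'a measure \<Rightarrow> 'a l2 set" where
  "L2 M = sq_int M // ae_rel M"

definition cls :: "'a measure \<Rightarrow> ('a \<Rightarrow> real) \<Rightarrow> 'a l2" where
  "cls M f = ae_rel M `` {f}"

definition l2_add :: "'a measure \<Rightarrow> 'a l2 \<Rightarrow> 'a l2 \<Rightarrow> 'a l2" where
  "l2_add M X Y = (\<Union>f\<in>X. \<Union>g\<in>Y. cls M (\<lambda>x. f x + g x))"

definition l2_diff :: "'a measure \<Rightarrow> 'a l2 \<Rightarrow> 'a l2 \<Rightarrow> 'a l2" where
  "l2_diff M X Y = (\<Union>f\<in>X. \<Union>g\<in>Y. cls M (\<lambda>x. f x - g x))"

definition l2_scale :: "'a measure \<Rightarrow> real \<Rightarrow> 'a l2 \<Rightarrow> 'a l2" where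
  "l2_scale M r X = (\<Union>f\<in>X. cls M (\<lambda>x. r * f x))"

text \<open>The inner product of the weighted space \<open>L\<^sup>2\<^bsub>1/w\<^esub>\<close>; \<open>w = 1\<close> gives the usual one. The
  union is a singleton on \<open>L2 M\<close>, see \<open>l2_inner_cls\<close> below.\<close>

definition l2_inner :: "'a measure \<Rightarrow> ('a \<Rightarrow> real) \<Rightarrow> 'a l2 \<Rightarrow> 'a l2 \<Rightarrow> real" where
  "l2_inner M w X Y = the_elem (\<Union>f\<in>X. \<Union>g\<in>Y. {\<integral>x. f x * g x / w x \<partial>M})"


section \<open>The product Hilbert space\<close>

definition hat_H :: "'a measure \<Rightarrow> ('a l2 \<times> 'a l2) set" where
  "hat_H M = L2 M \<times> L2 M"

definition hat_zero :: "'a measure \<Rightarrow> 'a l2 \<times> 'a l2" where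
  "hat_zero M = (cls M (\<lambda>_. 0), cls M (\<lambda>_. 0))"

definition hat_add :: "'a measure \<Rightarrow> 'a l2 \<times> 'a l2 \<Rightarrow> 'a l2 \<times> 'a l2 \<Rightarrow> 'a l2 \<times> 'a l2" where
  "hat_add M p q = (l2_add M (fst p) (fst q), l2_add M (snd p) (snd q))"

definition hat_diff :: "'a measure \<Rightarrow> 'a l2 \<times> 'a l2 \<Rightarrow> 'a l2 \<times> 'a l2 \<Rightarrow> 'a l2 \<times> 'a l2" where
  "hat_diff M p q = (l2_diff M (fst p) (fst q), l2_diff M (snd p) (snd q))"

definition hat_scale :: "'a measure \<Rightarrow> real \<Rightarrow> 'a l2 \<times> 'a l2 \<Rightarrow> 'a l2 \<times> 'a l2" where
  "hat_scale M r p = (l2_scale M r (fst p), l2_scale M r (snd p))"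

definition hat_inner :: "'a measure \<Rightarrow> ('a \<Rightarrow> real) \<Rightarrow> 'a l2 \<times> 'a l2 \<Rightarrow> 'a l2 \<times> 'a l2 \<Rightarrow> real" where
  "hat_inner M C p q = l2_inner M C (fst p) (fst q) + l2_inner M (\<lambda>_. 1) (snd p) (snd q)"

text \<open>The value off the carrier is immaterial; it is fixed because the locale
  \<open>Metric_space\<close> asks for nonnegativity and symmetry there as well.\<close>

definition hat_dist :: "'a measure \<Rightarrow> ('a \<Rightarrow> real) \<Rightarrow> 'a l2 \<times> 'a l2 \<Rightarrow> 'a l2 \<times> 'a l2 \<Rightarrow> real" where
  "hat_dist M C p q =
     (if p \<in> hat_H M \<and> q \<in> hat_H M
      then sqrt (hat_inner M C (hat_diff M p q) (hat_diff M p q)) else 0)"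

definition hat_topology :: "'a measure \<Rightarrow> ('a \<Rightarrow> real) \<Rightarrow> ('a l2 \<times> 'a l2) topology" where
  "hat_topology M C = Metric_space.mtopology (hat_H M) (hat_dist M C)"

definition hat_subspace :: "'a measure \<Rightarrow> ('a l2 \<times> 'a l2) set \<Rightarrow> bool" where
  "hat_subspace M S \<longleftrightarrow> S \<subseteq> hat_H M \<and> hat_zero M \<in> S \<and>
     (\<forall>p\<in>S. \<forall>q\<in>S. hat_add M p q \<in> S) \<and> (\<forall>r. \<forall>p\<in>S. hat_scale M r p \<in> S)"

definition set_diff ::
  "'a measure \<Rightarrow> ('a l2 \<times> 'a l2) set \<Rightarrow> ('a l2 \<times> 'a l2) set \<Rightarrow> ('a l2 \<times> 'a l2) set" where
  "set_diff M A B = {hat_diff M c1 c2 | c1 c2. c1 \<in> A \<and> c2 \<in> B}"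

definition cone_diff ::
  "'a measure \<Rightarrow> ('a l2 \<times> 'a l2) set \<Rightarrow> ('a l2 \<times> 'a l2) set \<Rightarrow> ('a l2 \<times> 'a l2) set" where
  "cone_diff M A B =
     {hat_scale M r (hat_diff M c1 c2) | r c1 c2. 0 \<le> r \<and> c1 \<in> A \<and> c2 \<in> B}"


section \<open>The rod with hardening\<close>

abbreviation Om :: "real \<Rightarrow> real \<Rightarrow> real measure" where
  "Om a b \<equiv> lebesgue_on {a<..<b}"

definition const_space :: "'a measure \<Rightarrow> 'a l2 set" where
  "const_space M = {cls M (\<lambda>_. v) | v. True}"

text \<open>A pair of classes belongs to the set iff some, equivalently every, pair of
  representatives satisfies the yield condition almost everywhere.\<close>

definition Sigma_hat ::
  "'a measure \<Rightarrow> ('a \<Rightarrow> real \<Rightarrow> real) \<Rightarrow> ('a \<Rightarrow> real \<Rightarrow> real) \<Rightarrow> ('a l2 \<times> 'a l2) set" where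
  "Sigma_hat M sm sp = {(cls M s, cls M z) | s z. s \<in> sq_int M \<and> z \<in> sq_int M \<and>
     (AE x in M. sm x (z x) \<le> s x \<and> s x \<le> sp x (z x))}"

definition shifted_Sigma ::
  "'a measure \<Rightarrow> ('a \<Rightarrow> real \<Rightarrow> real) \<Rightarrow> ('a \<Rightarrow> real \<Rightarrow> real) \<Rightarrow> 'a l2 \<Rightarrow> ('a l2 \<times> 'a l2) set" where
  "shifted_Sigma M sm sp T = (\<lambda>p. hat_diff M p (T, cls M (\<lambda>_. 0))) ` Sigma_hat M sm sp"

definition strictly_monotone :: "(real \<Rightarrow> real) \<Rightarrow> bool" where
  "strictly_monotone f \<longleftrightarrow> strict_mono f \<or> strict_antimono_on UNIV f"

definition yield_limits ::
  "'a measure \<Rightarrow> ('a \<Rightarrow> real \<Rightarrow> real) \<Rightarrow> ('a \<Rightarrow> real \<Rightarrow> real) \<Rightarrow> bool" where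
  "yield_limits M sm sp \<longleftrightarrow>
     (AE x in M. convex_on UNIV (sm x) \<and> strictly_monotone (sm x) \<and> surj (sm x)) \<and>
     (AE x in M. concave_on UNIV (sp x) \<and> strictly_monotone (sp x) \<and> surj (sp x))"

text \<open>The monotonicity here is strict in combination with \<open>yield_limits\<close>, so that
  \<open>inv\<close> below is a genuine two-sided inverse for almost all \<open>x\<close>.\<close>

definition expanding_range ::
  "'a measure \<Rightarrow> ('a \<Rightarrow> real \<Rightarrow> real) \<Rightarrow> ('a \<Rightarrow> real \<Rightarrow> real) \<Rightarrow> bool" where
  "expanding_range M sm sp \<longleftrightarrow>
     (AE x in M. mono (sp x) \<and> antimono (sm x)) \<and>
     (\<forall>z. (\<lambda>x. sm x z) \<in> borel_measurable M \<and> (\<lambda>x. sp x z) \<in> borel_measurable M) \<and>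
     (\<exists>\<psi>\<in>sq_int M. \<exists>c>0. AE x in M. \<forall>s.
        max \<bar>inv (sm x) s\<bar> \<bar>inv (sp x) s\<bar> \<le> \<psi> x + c * \<bar>s\<bar>)"

definition linear_kinematic ::
  "'a measure \<Rightarrow> ('a \<Rightarrow> real \<Rightarrow> real) \<Rightarrow> ('a \<Rightarrow> real \<Rightarrow> real) \<Rightarrow> bool" where
  "linear_kinematic M sm sp \<longleftrightarrow>
     (\<exists>om\<in>ess_bounded M. \<exists>op\<in>ess_bounded M. \<exists>H\<in>ess_bounded M. \<exists>\<eta>>0.
        (AE x in M. \<eta> \<le> H x) \<and>
        (AE x in M. \<forall>z. sm x z = om x + H x * z \<and> sp x z = op x + H x * z))"


section \<open>The operations on classes are well defined\<close>

lemma sq_int_combine: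
  assumes f: "f \<in> sq_int M" and g: "g \<in> sq_int M"
  shows "(\<lambda>x. r * f x + s * g x) \<in> sq_int M"
proof -
  have [measurable]: "f \<in> borel_measurable M" "g \<in> borel_measurable M"
    and i: "integrable M (\<lambda>x. (f x)\<^sup>2)" "integrable M (\<lambda>x. (g x)\<^sup>2)"
    using f g by (auto simp: sq_int_def)
  have "integrable M (\<lambda>x. (r * f x + s * g x)\<^sup>2)"
  proof (rule Bochner_Integration.integrable_bound)
    show "integrable M (\<lambda>x. 2 * r\<^sup>2 * (f x)\<^sup>2 + 2 * s\<^sup>2 * (g x)\<^sup>2)"
      using i by simp
    have "(r * f x + s * g x)\<^sup>2 \<le> 2 * r\<^sup>2 * (f x)\<^sup>2 + 2 * s\<^sup>2 * (g x)\<^sup>2" for x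
      using zero_le_power2[of "r * f x - s * g x"]
      by (simp add: power2_eq_square algebra_simps)
    then show "AE x in M. norm ((r * f x + s * g x)\<^sup>2)
        \<le> norm (2 * r\<^sup>2 * (f x)\<^sup>2 + 2 * s\<^sup>2 * (g x)\<^sup>2)"
      by (simp add: abs_of_nonneg)
  qed simp
  then show ?thesis by (simp add: sq_int_def)
qed

lemma sq_int_simps:
  assumes "f \<in> sq_int M" "g \<in> sq_int M"
  shows "(\<lambda>x. f x + g x) \<in> sq_int M" "(\<lambda>x. f x - g x) \<in> sq_int M" "(\<lambda>x. r * f x) \<in> sq_int M"
  using sq_int_combine[OF assms, of 1 1] sq_int_combine[OF assms, of 1 "-1"]
    sq_int_combine[OF assms, of r 0] by simp_all

lemma equiv_ae_rel: "equiv (sq_int M) (ae_rel M)"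
  by (rule equivI) (auto simp: ae_rel_def refl_on_def sym_def trans_def elim: eventually_elim2)

lemma cls_eq_iff:
  "f \<in> sq_int M \<Longrightarrow> g \<in> sq_int M \<Longrightarrow> cls M f = cls M g \<longleftrightarrow> (AE x in M. f x = g x)"
  unfolding cls_def by (subst eq_equiv_class_iff[OF equiv_ae_rel]) (auto simp: ae_rel_def)

lemma cls_in_L2: "f \<in> sq_int M \<Longrightarrow> cls M f \<in> L2 M"
  unfolding cls_def L2_def by (rule quotientI)

lemma L2_cases:
  assumes "X \<in> L2 M" obtains f where "f \<in> sq_int M" "X = cls M f"
  using assms unfolding cls_def L2_def by (auto elim: quotientE)

lemma l2_add_cls:
  assumes "f \<in> sq_int M" "g \<in> sq_int M"
  shows "l2_add M (cls M f) (cls M g) = cls M (\<lambda>x. f x + g x)"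
  unfolding l2_add_def cls_def[of M f] cls_def[of M g]
proof (rule UN_equiv_class2[OF equiv_ae_rel equiv_ae_rel _ assms])
  show "congruent2 (ae_rel M) (ae_rel M) (\<lambda>f g. cls M (\<lambda>x. f x + g x))"
    by (rule congruent2I') (auto simp: ae_rel_def cls_eq_iff sq_int_simps elim: eventually_elim2)
qed

lemma l2_diff_cls:
  assumes "f \<in> sq_int M" "g \<in> sq_int M"
  shows "l2_diff M (cls M f) (cls M g) = cls M (\<lambda>x. f x - g x)"
  unfolding l2_diff_def cls_def[of M f] cls_def[of M g]
proof (rule UN_equiv_class2[OF equiv_ae_rel equiv_ae_rel _ assms])
  show "congruent2 (ae_rel M) (ae_rel M) (\<lambda>f g. cls M (\<lambda>x. f x - g x))"
    by (rule congruent2I') (auto simp: ae_rel_def cls_eq_iff sq_int_simps elim: eventually_elim2)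
qed

lemma l2_scale_cls:
  assumes "f \<in> sq_int M"
  shows "l2_scale M r (cls M f) = cls M (\<lambda>x. r * f x)"
  unfolding l2_scale_def cls_def[of M f]
proof (rule UN_equiv_class[OF equiv_ae_rel _ assms])
  show "(\<lambda>f. cls M (\<lambda>x. r * f x)) respects ae_rel M"
    by (rule congruentI, rule cls_eq_iff[THEN iffD2]) (auto simp: ae_rel_def sq_int_simps)
qed

lemma l2_inner_cls:
  assumes "f \<in> sq_int M" "g \<in> sq_int M" and [measurable]: "w \<in> borel_measurable M"
  shows "l2_inner M w (cls M f) (cls M g) = (\<integral>x. f x * g x / w x \<partial>M)"
proof -
  have "(\<Union>f'\<in>cls M f. \<Union>g'\<in>cls M g. {\<integral>x. f' x * g' x / w x \<partial>M}) = {\<integral>x. f x * g x / w x \<partial>M}"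
    unfolding cls_def
  proof (rule UN_equiv_class2[OF equiv_ae_rel equiv_ae_rel _ assms(1,2)])
    show "congruent2 (ae_rel M) (ae_rel M) (\<lambda>f g. {\<integral>x. f x * g x / w x \<partial>M})"
    proof (rule congruent2I')
      fix f f' g g' assume "(f, f') \<in> ae_rel M" "(g, g') \<in> ae_rel M"
      then have ae: "AE x in M. f x = f' x" "AE x in M. g x = g' x"
        and [measurable]: "f \<in> borel_measurable M" "f' \<in> borel_measurable M"
          "g \<in> borel_measurable M" "g' \<in> borel_measurable M"
        by (auto simp: ae_rel_def sq_int_def)
      have "(\<integral>x. f x * g x / w x \<partial>M) = (\<integral>x. f' x * g' x / w x \<partial>M)"
      proof (rule integral_cong_AE)
        show "AE x in M. f x * g x / w x = f' x * g' x / w x"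
          using ae by eventually_elim simp
      qed measurable
      then show "{\<integral>x. f x * g x / w x \<partial>M} = {\<integral>x. f' x * g' x / w x \<partial>M}" by simp
    qed
  qed
  then show ?thesis by (simp add: l2_inner_def)
qed

lemma Metric_space_hat:
  fixes M :: "'a measure"
  assumes C [measurable]: "C \<in> borel_measurable M"
    and c0: "0 < c0" and lb: "AE x in M. c0 \<le> C x"
  shows "Metric_space (hat_H M) (hat_dist M C)"
proof -
  define N where "N f g = (\<integral>x. f x * f x / C x \<partial>M) + (\<integral>x. g x * g x \<partial>M)" for f g :: "'a \<Rightarrow> real"
  have dist: "hat_dist M C (cls M f, cls M g) (cls M f', cls M g')
      = sqrt (N (\<lambda>x. f x - f' x) (\<lambda>x. g x - g' x))"
    if "f \<in> sq_int M" "g \<in> sq_int M" "f' \<in> sq_int M" "g' \<in> sq_int M" for f g f' g'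
    using that
    by (simp add: hat_dist_def hat_H_def cls_in_L2 hat_inner_def hat_diff_def l2_diff_cls
        l2_inner_cls sq_int_simps N_def C)
  have pos: "AE x in M. 0 \<le> f x * f x / C x" for f :: "'a \<Rightarrow> real"
    using lb by eventually_elim (use c0 in auto)
  have int: "integrable M (\<lambda>x. f x * f x / C x)" "integrable M (\<lambda>x. f x * f x)"
    if "f \<in> sq_int M" for f
  proof -
    have [measurable]: "f \<in> borel_measurable M" and i: "integrable M (\<lambda>x. f x * f x)"
      using that by (auto simp: sq_int_def power2_eq_square)
    show "integrable M (\<lambda>x. f x * f x)" by fact
    show "integrable M (\<lambda>x. f x * f x / C x)"
    proof (rule Bochner_Integration.integrable_bound)
      show "integrable M (\<lambda>x. f x * f x / c0)" using i by simp
      show "AE x in M. norm (f x * f x / C x) \<le> norm (f x * f x / c0)"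
        using lb by eventually_elim (use c0 in \<open>auto intro!: divide_left_mono mult_pos_pos\<close>)
    qed measurable
  qed
  have Nnn: "0 \<le> N f g" for f g
    unfolding N_def by (intro add_nonneg_nonneg integral_nonneg_AE pos) auto
  have young: "N (\<lambda>x. f x + f' x) (\<lambda>x. g x + g' x) \<le> (1 + t) * N f g + (1 + 1/t) * N f' g'"
    if s: "f \<in> sq_int M" "g \<in> sq_int M" "f' \<in> sq_int M" "g' \<in> sq_int M" and t: "0 < t"
    for f g f' g' t
  proof -
    have pt: "(u + v) * (u + v) \<le> (1 + t) * (u * u) + (1 + 1/t) * (v * v)" for u v :: real
    proof -
      have "0 \<le> (t * u - v) * (t * u - v) / t" using t by simp
      also have "\<dots> = (1 + t) * (u * u) + (1 + 1/t) * (v * v) - (u + v) * (u + v)"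
        using t by (simp add: field_simps)
      finally show ?thesis by simp
    qed
    have "(\<integral>x. (f x + f' x) * (f x + f' x) / C x \<partial>M)
        \<le> (\<integral>x. (1 + t) * (f x * f x / C x) + (1 + 1/t) * (f' x * f' x / C x) \<partial>M)"
    proof (rule integral_mono_AE)
      show "AE x in M. (f x + f' x) * (f x + f' x) / C x
          \<le> (1 + t) * (f x * f x / C x) + (1 + 1/t) * (f' x * f' x / C x)"
        using lb
      proof eventually_elim
        case (elim x)
        have "(f x + f' x) * (f x + f' x) / C x
            \<le> ((1 + t) * (f x * f x) + (1 + 1/t) * (f' x * f' x)) / C x"
          by (rule divide_right_mono[OF pt]) (use elim c0 in auto)
        then show ?case by (simp add: add_divide_distrib)
      qed
    qed (intro Bochner_Integration.integrable_add integrable_mult_right int sq_int_simps s)+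
    also have "\<dots> = (1 + t) * (\<integral>x. f x * f x / C x \<partial>M) + (1 + 1/t) * (\<integral>x. f' x * f' x / C x \<partial>M)"
      using s int by (subst Bochner_Integration.integral_add) (auto simp del: times_divide_eq_right)
    finally have 1: "(\<integral>x. (f x + f' x) * (f x + f' x) / C x \<partial>M)
      \<le> (1 + t) * (\<integral>x. f x * f x / C x \<partial>M) + (1 + 1/t) * (\<integral>x. f' x * f' x / C x \<partial>M)" .
    have "(\<integral>x. (g x + g' x) * (g x + g' x) \<partial>M)
        \<le> (\<integral>x. (1 + t) * (g x * g x) + (1 + 1/t) * (g' x * g' x) \<partial>M)"
      by (rule integral_mono) (use int(2)[OF sq_int_simps(1)[OF s(2,4)]] s int pt in auto)
    also have "\<dots> = (1 + t) * (\<integral>x. g x * g x \<partial>M) + (1 + 1/t) * (\<integral>x. g' x * g' x \<partial>M)"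
      using s int by (subst Bochner_Integration.integral_add) auto
    finally have "(\<integral>x. (g x + g' x) * (g x + g' x) \<partial>M)
      \<le> (1 + t) * (\<integral>x. g x * g x \<partial>M) + (1 + 1/t) * (\<integral>x. g' x * g' x \<partial>M)" .
    with 1 show ?thesis unfolding N_def ring_distribs by linarith
  qed
  have mink: "sqrt (N (\<lambda>x. f x + f' x) (\<lambda>x. g x + g' x)) \<le> sqrt (N f g) + sqrt (N f' g')"
    if s: "f \<in> sq_int M" "g \<in> sq_int M" "f' \<in> sq_int M" "g' \<in> sq_int M" for f g f' g'
  proof (rule field_le_epsilon)
    fix e :: real assume e: "0 < e"
    define p q where "p = sqrt (N f g) + e / 2" and "q = sqrt (N f' g') + e / 2"
    have pq: "0 < p" "0 < q" using e Nnn by (auto simp: p_def q_def add_nonneg_pos)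
    have le: "N f g \<le> p\<^sup>2" "N f' g' \<le> q\<^sup>2"
      using e Nnn by (auto simp: p_def q_def intro!: sqrt_le_D)
    have "N (\<lambda>x. f x + f' x) (\<lambda>x. g x + g' x) \<le> (1 + q/p) * N f g + (1 + 1/(q/p)) * N f' g'"
      by (rule young[OF s]) (use pq in simp)
    also have "\<dots> \<le> (1 + q/p) * p\<^sup>2 + (1 + 1/(q/p)) * q\<^sup>2"
      by (intro add_mono mult_left_mono le) (use pq in auto)
    also have "\<dots> = (p + q)\<^sup>2"
      using pq by (simp add: field_simps power2_eq_square)
    finally have "sqrt (N (\<lambda>x. f x + f' x) (\<lambda>x. g x + g' x)) \<le> p + q"
      using pq by (intro real_le_lsqrt) auto
    then show "sqrt (N (\<lambda>x. f x + f' x) (\<lambda>x. g x + g' x)) \<le> sqrt (N f g) + sqrt (N f' g') + e"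
      by (simp add: p_def q_def)
  qed
  have rep: "\<exists>f g. f \<in> sq_int M \<and> g \<in> sq_int M \<and> p = (cls M f, cls M g)" if "p \<in> hat_H M" for p
    using that unfolding hat_H_def by (auto elim!: L2_cases)
  show ?thesis
  proof
    fix p q
    show "0 \<le> hat_dist M C p q"
    proof (cases "p \<in> hat_H M \<and> q \<in> hat_H M")
      case True
      then obtain f g f' g' where "f \<in> sq_int M" "g \<in> sq_int M" "f' \<in> sq_int M" "g' \<in> sq_int M"
        "p = (cls M f, cls M g)" "q = (cls M f', cls M g')" by (meson rep)
      then show ?thesis by (simp add: dist Nnn)
    qed (auto simp: hat_dist_def)
    show "hat_dist M C p q = hat_dist M C q p"
    proof (cases "p \<in> hat_H M \<and> q \<in> hat_H M")
      case True
      then obtain f g f' g' where "f \<in> sq_int M" "g \<in> sq_int M" "f' \<in> sq_int M" "g' \<in> sq_int M"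
        "p = (cls M f, cls M g)" "q = (cls M f', cls M g')" by (meson rep)
      then show ?thesis by (simp add: dist N_def algebra_simps)
    qed (auto simp: hat_dist_def)
  next
    fix p q assume "p \<in> hat_H M" "q \<in> hat_H M"
    then obtain f g f' g' where s: "f \<in> sq_int M" "g \<in> sq_int M" "f' \<in> sq_int M" "g' \<in> sq_int M"
      and pq: "p = (cls M f, cls M g)" "q = (cls M f', cls M g')" by (meson rep)
    let ?f = "\<lambda>x. f x - f' x" and ?g = "\<lambda>x. g x - g' x"
    have "hat_dist M C p q = 0 \<longleftrightarrow> N ?f ?g = 0"
      using s by (simp add: pq dist)
    also have "\<dots> \<longleftrightarrow> (\<integral>x. ?f x * ?f x / C x \<partial>M) = 0 \<and> (\<integral>x. ?g x * ?g x \<partial>M) = 0"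
      unfolding N_def by (rule add_nonneg_eq_0_iff) (intro integral_nonneg_AE pos, simp)
    also have "\<dots> \<longleftrightarrow> (AE x in M. ?f x * ?f x / C x = 0) \<and> (AE x in M. ?g x * ?g x = 0)"
      by (intro arg_cong2[where f="(\<and>)"] integral_nonneg_eq_0_iff_AE pos int sq_int_simps s) auto
    also have "(AE x in M. ?f x * ?f x / C x = 0) \<longleftrightarrow> (AE x in M. f x = f' x)"
      using lb by (intro eventually_cong[OF lb] iffI) (use c0 in auto)
    also have "(AE x in M. ?g x * ?g x = 0) \<longleftrightarrow> (AE x in M. g x = g' x)"
      by simp
    also have "(AE x in M. f x = f' x) \<and> (AE x in M. g x = g' x) \<longleftrightarrow> p = q"
      using s by (simp add: pq cls_eq_iff)
    finally show "hat_dist M C p q = 0 \<longleftrightarrow> p = q" .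
  next
    fix p q r assume "p \<in> hat_H M" "q \<in> hat_H M" "r \<in> hat_H M"
    then obtain f g f' g' f'' g'' where s: "f \<in> sq_int M" "g \<in> sq_int M"
      "f' \<in> sq_int M" "g' \<in> sq_int M" "f'' \<in> sq_int M" "g'' \<in> sq_int M"
      and pq: "p = (cls M f, cls M g)" "q = (cls M f', cls M g')" "r = (cls M f'', cls M g'')"
      by (meson rep)
    have "sqrt (N (\<lambda>x. (f x - f' x) + (f' x - f'' x)) (\<lambda>x. (g x - g' x) + (g' x - g'' x)))
      \<le> sqrt (N (\<lambda>x. f x - f' x) (\<lambda>x. g x - g' x)) + sqrt (N (\<lambda>x. f' x - f'' x) (\<lambda>x. g' x - g'' x))"
      by (rule mink) (use s in \<open>auto intro: sq_int_simps\<close>)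
    then show "hat_dist M C p r \<le> hat_dist M C p q + hat_dist M C q r"
      using s by (simp add: pq dist)
  qed
qed

end

(* Everything rests on C1 - C2 being the whole space. Since the second component of C2 is
   unrestricted, this only asks for a square integrable internal variable z with
   sm x (z x) \<le> h x \<le> sp x (z x) for an arbitrary square integrable stress h. With an expanding
   range the larger of the two inverse yield limits at h x works; with kinematic hardening one
   solves sp x (z x) = h x. Condition (i) fails because adding small multiples of the
   non-constant function x to a point of C2 leaves C2. *)
theory Submission
  imports Defs
begin

section \<open>Square integrability by domination\<close>

lemma abs_sq_int: "f \<in> sq_int M \<Longrightarrow> (\<lambda>x. \<bar>f x\<bar>) \<in> sq_int M"
  by (auto simp: sq_int_def)

lemma sq_int_bound:
  assumes g: "g \<in> sq_int M" and [measurable]: "f \<in> borel_measurable M"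
    and le: "AE x in M. \<bar>f x\<bar> \<le> g x"
  shows "f \<in> sq_int M"
proof -
  have "integrable M (\<lambda>x. (f x)\<^sup>2)"
  proof (rule Bochner_Integration.integrable_bound)
    show "integrable M (\<lambda>x. (g x)\<^sup>2)" using g by (simp add: sq_int_def)
    show "AE x in M. norm ((f x)\<^sup>2) \<le> norm ((g x)\<^sup>2)"
      using le by eventually_elim (simp add: abs_le_square_iff[symmetric])
  qed measurable
  then show ?thesis by (simp add: sq_int_def)
qed

lemma (in finite_measure) const_sq_int: "(\<lambda>_. v) \<in> sq_int M"
  by (simp add: sq_int_def)

lemma (in finite_measure) ess_bounded_sq_int:
  assumes "f \<in> ess_bounded M"
  shows "f \<in> sq_int M"
proof -
  from assms obtain K where "f \<in> borel_measurable M" "AE x in M. \<bar>f x\<bar> \<le> K"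
    by (auto simp: ess_bounded_def)
  then show ?thesis by (rule sq_int_bound[OF const_sq_int])
qed

section \<open>Inverse yield limits and admissible internal variables\<close>

lemma strict_mono_if_mono: "strictly_monotone f \<Longrightarrow> mono f \<Longrightarrow> strict_mono f"
  using monotone_onD[of UNIV "(<)" "\<lambda>x y. y < x" f 0 1] monoD[of f 0 1]
  by (auto simp: strictly_monotone_def)

lemma strict_antimono_if_antimono:
  "strictly_monotone f \<Longrightarrow> antimono f \<Longrightarrow> strict_antimono_on UNIV f"
  using strict_monoD[of f 0 1] antimonoD[of f 0 1]
  by (auto simp: strictly_monotone_def)

text \<open>A strictly increasing function preserves and reflects order, so \<open>f\<close> may be
  applied to both sides. Sublevel sets of the inverse thereby become conditions on \<open>f\<close>
  itself, which yields both admissibility and measurability of the selected internal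
  variable.\<close>

lemma inv_le_iff_strict_mono:
  fixes f :: "real \<Rightarrow> real"
  assumes "strict_mono f" "surj f"
  shows "inv f s \<le> r \<longleftrightarrow> s \<le> f r"
  using strict_mono_less_eq[OF assms(1), of "inv f s" r] assms(2) by (simp add: surj_f_inv_f)

lemma inv_le_iff_strict_antimono:
  fixes f :: "real \<Rightarrow> real"
  assumes f: "strict_antimono_on UNIV f" and "surj f"
  shows "inv f s \<le> r \<longleftrightarrow> f r \<le> s"
proof -
  have "strict_mono (\<lambda>x. - f x)"
    using f by (auto simp: monotone_on_def)
  from strict_mono_less_eq[OF this, of "inv f s" r] show ?thesis
    using \<open>surj f\<close> by (simp add: surj_f_inv_f)
qed

text \<open>Almost everywhere the admissible values for the stress \<open>h x\<close> form the
  half-line starting at \<open>w x\<close>, the maximum of the two inverses. Its left endpoint is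
  therefore admissible, its sublevel sets are measurable, and the linear growth bound on the
  inverses makes it square integrable.\<close>

lemma expanding_range_selection:
  assumes y: "yield_limits M sm sp" and e: "expanding_range M sm sp" and h: "h \<in> sq_int M"
  obtains z where "z \<in> sq_int M" "AE x in M. sm x (z x) \<le> h x \<and> h x \<le> sp x (z x)"
proof -
  define w where "w x = max (inv (sm x) (h x)) (inv (sp x) (h x))" for x
  from e obtain \<psi> c where \<psi>: "\<psi> \<in> sq_int M" and "c > 0"
    and bd: "AE x in M. \<forall>s. max \<bar>inv (sm x) s\<bar> \<bar>inv (sp x) s\<bar> \<le> \<psi> x + c * \<bar>s\<bar>"
    unfolding expanding_range_def by blast
  have [measurable]: "h \<in> borel_measurable M"
    "(\<lambda>x. sm x r) \<in> borel_measurable M" "(\<lambda>x. sp x r) \<in> borel_measurable M" for r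
    using e h by (auto simp: expanding_range_def sq_int_def)
  from y e have "AE x in M. \<forall>r. w x \<le> r \<longleftrightarrow> sm x r \<le> h x \<and> h x \<le> sp x r"
    unfolding yield_limits_def expanding_range_def
    by (auto simp: w_def inv_le_iff_strict_mono inv_le_iff_strict_antimono
        strict_mono_if_mono strict_antimono_if_antimono elim!: eventually_elim2)
  \<comment> \<open>The measure need not be complete, so the selection is altered on a null set.\<close>
  then obtain N where N: "N \<in> null_sets M"
    and w: "\<And>x r. x \<in> space M - N \<Longrightarrow> w x \<le> r \<longleftrightarrow> sm x r \<le> h x \<and> h x \<le> sp x r"
    by (auto elim!: AE_E3)
  then have [measurable]: "N \<in> sets M" by auto
  define z where "z x = (if x \<in> N then 0 else w x)" for x
  have zw: "AE x in M. z x = w x"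
    using AE_not_in[OF N] by eventually_elim (simp add: z_def)
  have meas: "z \<in> borel_measurable M"
  proof (subst borel_measurable_iff_le, intro allI)
    fix r
    \<comment> \<open>For fixed \<open>r\<close> the inverses disappear: only \<open>h\<close> and
      the sections of \<open>sm\<close> and \<open>sp\<close> at \<open>r\<close> remain, and these
      are measurable in \<open>x\<close>. The condition \<open>0 \<le> r\<close> comes from the
      value 0 given to \<open>z\<close> on \<open>N\<close>.\<close>
    have "{x \<in> space M. z x \<le> r} =
      {x \<in> space M. x \<in> N \<and> 0 \<le> r \<or> x \<notin> N \<and> sm x r \<le> h x \<and> h x \<le> sp x r}"
      by (auto simp: z_def w split: if_splits)
    also have "\<dots> \<in> sets M" by measurable
    finally show "{x \<in> space M. z x \<le> r} \<in> sets M" .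
  qed
  show ?thesis
  proof
    have "(\<lambda>x. 1 * \<psi> x + c * \<bar>h x\<bar>) \<in> sq_int M"
      by (intro sq_int_combine abs_sq_int \<psi> h)
    then show "z \<in> sq_int M"
    proof (rule sq_int_bound[OF _ meas])
      show "AE x in M. \<bar>z x\<bar> \<le> 1 * \<psi> x + c * \<bar>h x\<bar>"
        using bd zw
      proof eventually_elim
        case (elim x)
        then have "max \<bar>inv (sm x) (h x)\<bar> \<bar>inv (sp x) (h x)\<bar> \<le> \<psi> x + c * \<bar>h x\<bar>" by blast
        then show ?case using elim(2) by (auto simp: w_def)
      qed
    qed
    \<comment> \<open>The equivalence \<open>w\<close> is used at the endpoint
      \<open>r = w x\<close>.\<close>
    show "AE x in M. sm x (z x) \<le> h x \<and> h x \<le> sp x (z x)"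
      using AE_not_in[OF N] AE_space by eventually_elim (use w in \<open>auto simp: z_def\<close>)
  qed
qed

text \<open>The witness \<open>(h x - op x) / H x\<close> solves \<open>sp x z = h x\<close>, so the
  upper bound holds with equality. Dividing by \<open>H x\<close>, which is at least
  \<open>\<eta>\<close>, preserves square integrability of \<open>h - op\<close>.\<close>

lemma (in finite_measure) linear_kinematic_selection:
  assumes l: "linear_kinematic M sm sp" and less: "AE x in M. sm x (\<xi> x) < sp x (\<xi> x)"
    and h: "h \<in> sq_int M"
  obtains z where "z \<in> sq_int M" "AE x in M. sm x (z x) \<le> h x \<and> h x \<le> sp x (z x)"
proof -
  from l obtain om op H \<eta> where op: "op \<in> ess_bounded M" and H: "H \<in> ess_bounded M" and "\<eta> > 0"
    and lb: "AE x in M. \<eta> \<le> H x"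
    and lin: "AE x in M. \<forall>z. sm x z = om x + H x * z \<and> sp x z = op x + H x * z"
    unfolding linear_kinematic_def by blast
  have [measurable]: "h \<in> borel_measurable M" "op \<in> borel_measurable M" "H \<in> borel_measurable M"
    using h op H by (auto simp: sq_int_def ess_bounded_def)
  show ?thesis
  proof
    have d: "(\<lambda>x. \<bar>h x - op x\<bar>) \<in> sq_int M"
      by (intro abs_sq_int sq_int_simps(2) h ess_bounded_sq_int op)
    have "(\<lambda>x. (1 / \<eta>) * \<bar>h x - op x\<bar>) \<in> sq_int M"
      by (rule sq_int_simps(3)[OF d d])
    then show "(\<lambda>x. (h x - op x) / H x) \<in> sq_int M"
    proof (rule sq_int_bound)
      show "AE x in M. \<bar>(h x - op x) / H x\<bar> \<le> (1 / \<eta>) * \<bar>h x - op x\<bar>"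
        using lb
      proof eventually_elim
        case (elim x)
        then show ?case
          using \<open>\<eta> > 0\<close> divide_left_mono[of \<eta> "H x" "\<bar>h x - op x\<bar>"] by (simp add: abs_divide)
      qed
    qed measurable
    \<comment> \<open>In \<open>less\<close> the common term \<open>H x * \<xi> x\<close> cancels,
      leaving \<open>om x < op x\<close>. Hence \<open>sm\<close> lies below \<open>sp\<close> at
      the witness as well, which gives the lower bound.\<close>
    show "AE x in M. sm x ((h x - op x) / H x) \<le> h x \<and> h x \<le> sp x ((h x - op x) / H x)"
      using lb lin less by eventually_elim (use \<open>\<eta> > 0\<close> in auto)
  qed
qed

section \<open>The product space: difference set, generated cone and interior\<close>

lemma hat_subspace_hat_H:
  assumes "(\<lambda>_. 0) \<in> sq_int M"
  shows "hat_subspace M (hat_H M)"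
  unfolding hat_subspace_def hat_H_def hat_zero_def hat_add_def hat_scale_def
  using assms
  by (auto simp: cls_in_L2 l2_add_cls l2_scale_cls sq_int_simps elim!: L2_cases)

lemma hat_diff_in_hat_H: "p \<in> hat_H M \<Longrightarrow> q \<in> hat_H M \<Longrightarrow> hat_diff M p q \<in> hat_H M"
  unfolding hat_H_def hat_diff_def
  by (auto simp: cls_in_L2 l2_diff_cls sq_int_simps elim!: L2_cases)

lemma shifted_Sigma_subset:
  assumes "T \<in> L2 M" "(\<lambda>_. 0) \<in> sq_int M"
  shows "shifted_Sigma M sm sp T \<subseteq> hat_H M"
  unfolding shifted_Sigma_def
proof (intro image_subsetI hat_diff_in_hat_H)
  show "p \<in> hat_H M" if "p \<in> Sigma_hat M sm sp" for p
    using that by (auto simp: Sigma_hat_def hat_H_def cls_in_L2)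
  show "(T, cls M (\<lambda>_. 0)) \<in> hat_H M"
    using assms by (simp add: hat_H_def cls_in_L2)
qed

text \<open>To reach \<open>(f, g)\<close>, select \<open>z\<close> admissible for the stress
  \<open>h = f + t\<close>, where \<open>t\<close> represents \<open>T\<close>. The shift turns
  \<open>(h, z)\<close> into \<open>(f, z)\<close>, and subtracting \<open>(0, z - g)\<close>, whose
  first component is a constant, corrects the second component.\<close>

lemma set_diff_shifted_Sigma:
  assumes sel: "\<And>h. h \<in> sq_int M \<Longrightarrow>
      \<exists>z \<in> sq_int M. AE x in M. sm x (z x) \<le> h x \<and> h x \<le> sp x (z x)"
    and T: "T \<in> L2 M" and const: "\<And>v. (\<lambda>_. v) \<in> sq_int M"
  shows "set_diff M (shifted_Sigma M sm sp T) (const_space M \<times> L2 M) = hat_H M"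
proof
  have "const_space M \<times> L2 M \<subseteq> hat_H M"
    using const by (auto simp: const_space_def hat_H_def cls_in_L2)
  then show "set_diff M (shifted_Sigma M sm sp T) (const_space M \<times> L2 M) \<subseteq> hat_H M"
    using shifted_Sigma_subset[OF T const] unfolding set_diff_def by (blast intro: hat_diff_in_hat_H)
next
  show "hat_H M \<subseteq> set_diff M (shifted_Sigma M sm sp T) (const_space M \<times> L2 M)"
  proof
    fix p assume "p \<in> hat_H M"
    then obtain f g where f: "f \<in> sq_int M" and g: "g \<in> sq_int M" and p: "p = (cls M f, cls M g)"
      by (auto simp: hat_H_def elim!: L2_cases)
    from T obtain t where t: "t \<in> sq_int M" and T': "T = cls M t" by (rule L2_cases)
    define h where "h x = f x + t x" for x
    have h: "h \<in> sq_int M" unfolding h_def by (rule sq_int_simps f t)+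
    with sel obtain z where z: "z \<in> sq_int M"
      and adm: "AE x in M. sm x (z x) \<le> h x \<and> h x \<le> sp x (z x)" by blast
    have "(cls M h, cls M z) \<in> Sigma_hat M sm sp"
      using h z adm by (auto simp: Sigma_hat_def)
    then have "hat_diff M (cls M h, cls M z) (T, cls M (\<lambda>_. 0)) \<in> shifted_Sigma M sm sp T"
      by (simp add: shifted_Sigma_def)
    moreover have "hat_diff M (cls M h, cls M z) (T, cls M (\<lambda>_. 0)) = (cls M f, cls M z)"
      using h z t const by (simp add: hat_diff_def T' l2_diff_cls) (simp add: h_def)
    moreover have "(cls M (\<lambda>_. 0), cls M (\<lambda>x. z x - g x)) \<in> const_space M \<times> L2 M"
      using z g by (auto simp: const_space_def cls_in_L2 sq_int_simps)
    moreover have "p = hat_diff M (cls M f, cls M z) (cls M (\<lambda>_. 0), cls M (\<lambda>x. z x - g x))"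
      using f g z const by (simp add: p hat_diff_def l2_diff_cls sq_int_simps)
    ultimately show "p \<in> set_diff M (shifted_Sigma M sm sp T) (const_space M \<times> L2 M)"
      unfolding set_diff_def by auto
  qed
qed

lemma hat_scale_one: "p \<in> hat_H M \<Longrightarrow> hat_scale M 1 p = p"
  by (auto simp: hat_H_def hat_scale_def l2_scale_cls elim!: L2_cases)

text \<open>Closure of \<open>hat_H M\<close> under scaling gives one inclusion, the factor 1 the
  other.\<close>

lemma cone_diff_eq_hat_H:
  assumes d: "set_diff M A B = hat_H M" and z: "(\<lambda>_. 0) \<in> sq_int M"
  shows "cone_diff M A B = hat_H M"
proof
  show "cone_diff M A B \<subseteq> hat_H M"
  proof
    fix p assume "p \<in> cone_diff M A B"
    then obtain r q where "p = hat_scale M r q" "q \<in> set_diff M A B"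
      unfolding cone_diff_def set_diff_def by blast
    then show "p \<in> hat_H M"
      using d hat_subspace_hat_H[OF z] by (auto simp: hat_subspace_def)
  qed
  show "hat_H M \<subseteq> cone_diff M A B"
  proof
    fix p assume p: "p \<in> hat_H M"
    then obtain c1 c2 where "c1 \<in> A" "c2 \<in> B" "p = hat_diff M c1 c2"
      unfolding d[symmetric] set_diff_def by blast
    moreover have "p = hat_scale M 1 p" using p by (simp add: hat_scale_one)
    ultimately show "p \<in> cone_diff M A B"
      unfolding cone_diff_def by (metis (mono_tags, lifting) mem_Collect_eq zero_le_one)
  qed
qed

text \<open>Every ball around a point \<open>p\<close> of the product contains a translate of
  \<open>p\<close> by a small positive multiple of \<open>f\<close> in the first component. If that
  component were still constant, \<open>f\<close> would be constant almost everywhere.\<close>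

lemma interior_const_space_Times_L2:
  assumes C: "C \<in> borel_measurable M" and "0 < c0" and lb: "AE x in M. c0 \<le> C x"
    and const: "\<And>v. (\<lambda>_. v) \<in> sq_int M"
    and f: "f \<in> sq_int M" and nonconst: "\<And>v. \<not> (AE x in M. f x = v)"
  shows "hat_topology M C interior_of (const_space M \<times> L2 M) = {}"
proof -
  interpret Metric_space "hat_H M" "hat_dist M C"
    by (rule Metric_space_hat[OF C \<open>0 < c0\<close> lb])
  have False if "p \<in> hat_topology M C interior_of (const_space M \<times> L2 M)" for p
  proof -
    from that obtain U where "openin mtopology U" "p \<in> U" and U: "U \<subseteq> const_space M \<times> L2 M"
      unfolding hat_topology_def interior_of_def by auto
    then obtain r where "r > 0" and r: "mball p r \<subseteq> U" and "p \<in> hat_H M"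
      unfolding openin_mtopology by blast
    from \<open>p \<in> U\<close> U obtain v g where g: "g \<in> sq_int M" and p: "p = (cls M (\<lambda>_. v), cls M g)"
      by (auto simp: const_space_def elim!: L2_cases)
    define K where "K = (\<integral>x. f x * f x / C x \<partial>M)"
    \<comment> \<open>The translate has distance \<open>e * sqrt K\<close> from \<open>p\<close>,
      which must be less than \<open>r\<close>; the summand 1 keeps the denominator positive even if
      \<open>K = 0\<close>.\<close>
    define e where "e = r / (sqrt K + 1)"
    have "K \<ge> 0" unfolding K_def
      by (rule integral_nonneg_AE, use lb in eventually_elim) (use \<open>0 < c0\<close> in auto)
    then have "sqrt K + 1 > 0" by (simp add: add_nonneg_pos)
    then have "e > 0" and e: "e * sqrt K < r"
      using \<open>r > 0\<close> by (simp_all add: e_def field_simps)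
    have vf: "(\<lambda>x. v + e * f x) \<in> sq_int M"
      by (rule sq_int_simps(1)[OF const sq_int_simps(3)[OF f f]])
    let ?q = "(cls M (\<lambda>x. v + e * f x), cls M g)"
    have "?q \<in> hat_H M" using vf g by (simp add: hat_H_def cls_in_L2)
    have d: "hat_diff M p ?q = (cls M (\<lambda>x. - e * f x), cls M (\<lambda>_. 0))"
      using vf g const by (simp add: p hat_diff_def l2_diff_cls)
    have ef: "(\<lambda>x. - e * f x) \<in> sq_int M" by (rule sq_int_simps(3)[OF f f])
    have "hat_inner M C (hat_diff M p ?q) (hat_diff M p ?q)
        = (\<integral>x. (- e * f x) * (- e * f x) / C x \<partial>M)"
      unfolding d hat_inner_def fst_conv snd_conv l2_inner_cls[OF ef ef C]
      by (simp add: l2_inner_cls const)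
    also have "\<dots> = (\<integral>x. e\<^sup>2 * (f x * f x / C x) \<partial>M)"
      by (simp add: power2_eq_square algebra_simps)
    also have "\<dots> = e\<^sup>2 * K" unfolding K_def by (rule integral_mult_right_zero)
    finally have "hat_dist M C p ?q = e * sqrt K"
      using \<open>p \<in> hat_H M\<close> \<open>?q \<in> hat_H M\<close> \<open>e > 0\<close> by (simp add: hat_dist_def real_sqrt_mult)
    then have "?q \<in> mball p r"
      using \<open>p \<in> hat_H M\<close> \<open>?q \<in> hat_H M\<close> e by simp
    then have "cls M (\<lambda>x. v + e * f x) \<in> const_space M"
      using r U by blast
    then obtain v' where "cls M (\<lambda>x. v + e * f x) = cls M (\<lambda>_. v')"
      by (auto simp: const_space_def)
    then have "AE x in M. v + e * f x = v'"
      using vf const by (simp add: cls_eq_iff)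
    then have "AE x in M. f x = (v' - v) / e"
      by eventually_elim (use \<open>e > 0\<close> in \<open>simp add: field_simps\<close>)
    then show False using nonconst by blast
  qed
  then show ?thesis by blast
qed

section \<open>The interval and its non-constant test function\<close>

lemma finite_measure_Om: "finite_measure (Om a b)"
  by (rule finite_measureI) (cases "a \<le> b"; simp add: emeasure_restrict_space)

lemma identity_sq_int_Om: "(\<lambda>x. x) \<in> sq_int (Om a b)"
proof (rule finite_measure.ess_bounded_sq_int[OF finite_measure_Om])
  have "AE x in Om a b. \<bar>x\<bar> \<le> \<bar>a\<bar> + \<bar>b\<bar>"
    by (rule AE_I2) auto
  then show "(\<lambda>x. x) \<in> ess_bounded (Om a b)"
    unfolding ess_bounded_def by (auto intro!: measurable_restrict_space1 measurable_completion)
qed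

text \<open>The point \<open>v\<close> is a null set, so the identity being equal to
  \<open>v\<close> almost everywhere would make the whole interval null, against its positive
  length.\<close>

lemma identity_not_AE_constant_Om:
  assumes "a < b"
  shows "\<not> (AE x in Om a b. x = v)"
proof
  assume "AE x in Om a b. x = v"
  then have "AE x in lebesgue. x \<in> {a<..<b} \<longrightarrow> x = v"
    by (simp add: AE_restrict_space_iff)
  moreover have "AE x in lebesgue. x \<noteq> v"
    by (rule AE_I'[of "{v}"]) auto
  ultimately have "AE x in lebesgue. x \<notin> {a<..<b}"
    by eventually_elim auto
  then have "emeasure lebesgue {a<..<b} = 0"
    by (subst (asm) AE_iff_measurable[of "{a<..<b}"]) auto
  then show False using assms by simp
qed

theorem proposition6p5:
  fixes a b c0 C0 :: real
    and C \<xi>0 :: "real \<Rightarrow> real"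
    and \<sigma>m \<sigma>p :: "real \<Rightarrow> real \<Rightarrow> real"
    and T :: "real l2"
  assumes "a < b"
    and "C \<in> ess_bounded (Om a b)"
    and "0 < c0"
    and "AE x in Om a b. c0 \<le> C x \<and> C x \<le> C0"
    and "yield_limits (Om a b) \<sigma>m \<sigma>p"
    and "\<xi>0 \<in> sq_int (Om a b)"
    and "AE x in Om a b. \<sigma>m x (\<xi>0 x) < \<sigma>p x (\<xi>0 x)"
    and "expanding_range (Om a b) \<sigma>m \<sigma>p \<or> linear_kinematic (Om a b) \<sigma>m \<sigma>p"
    and "T \<in> L2 (Om a b)"
  defines "C1 \<equiv> shifted_Sigma (Om a b) \<sigma>m \<sigma>p T"
    and "C2 \<equiv> const_space (Om a b) \<times> L2 (Om a b)"
    and "\<H> \<equiv> hat_topology (Om a b) C"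
  shows "\<not> (C1 \<inter> (\<H> interior_of C2) \<noteq> {}) \<and>
    hat_zero (Om a b) \<in> \<H> interior_of (set_diff (Om a b) C1 C2) \<and>
    cone_diff (Om a b) C1 C2 = hat_H (Om a b) \<and>
    (closedin \<H> (cone_diff (Om a b) C1 C2) \<and> hat_subspace (Om a b) (cone_diff (Om a b) C1 C2))"
proof -
  let ?M = "Om a b"
  interpret finite_measure ?M by (rule finite_measure_Om)
  have C: "C \<in> borel_measurable ?M" using assms(2) by (simp add: ess_bounded_def)
  have lb: "AE x in ?M. c0 \<le> C x" using assms(4) by eventually_elim simp
  have const: "(\<lambda>_. v) \<in> sq_int ?M" for v by (rule const_sq_int)
  interpret Metric_space "hat_H ?M" "hat_dist ?M C"
    by (rule Metric_space_hat[OF C \<open>0 < c0\<close> lb])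
  have "\<exists>z \<in> sq_int ?M. AE x in ?M. \<sigma>m x (z x) \<le> h x \<and> h x \<le> \<sigma>p x (z x)"
    if "h \<in> sq_int ?M" for h
    using assms(8)
  proof
    assume "expanding_range ?M \<sigma>m \<sigma>p"
    from expanding_range_selection[OF assms(5) this that] show ?thesis by blast
  next
    assume "linear_kinematic ?M \<sigma>m \<sigma>p"
    from linear_kinematic_selection[of \<sigma>m \<sigma>p \<xi>0 h, OF this assms(7) that] show ?thesis by blast
  qed
  then have d: "set_diff ?M C1 C2 = hat_H ?M"
    unfolding C1_def C2_def using \<open>T \<in> L2 ?M\<close> const by (rule set_diff_shifted_Sigma)
  then have k: "cone_diff ?M C1 C2 = hat_H ?M"
    using const by (rule cone_diff_eq_hat_H)
  have top: "topspace \<H> = hat_H ?M" by (simp add: \<H>_def hat_topology_def)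
  have "\<H> interior_of C2 = {}"
    unfolding C2_def \<H>_def
    by (rule interior_const_space_Times_L2[OF C \<open>0 < c0\<close> lb const identity_sq_int_Om
          identity_not_AE_constant_Om[OF \<open>a < b\<close>]])
  moreover have "hat_subspace ?M (hat_H ?M)" using const by (rule hat_subspace_hat_H)
  \<comment> \<open>Since the difference set and the cone are the whole space, (ii) and the
    closedness in (iv) reduce to \<open>topspace\<close> being open and closed.\<close>
  moreover have "\<H> interior_of hat_H ?M = hat_H ?M"
    by (metis interior_of_topspace top)
  moreover have "closedin \<H> (hat_H ?M)"
    by (metis closedin_topspace top)
  ultimately show ?thesis
    using d k by (simp add: hat_subspace_def)
qed

end
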